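(* Let $(X,p)$ and $(Y,q)$ be two quasi-normed cones. Let $T:X\to Y$ be an onto, continuous linear mapping such that $G_{\ker T}$ is closed in $(X,\mathcal{T}(d_p))$. Let $\tilde T: X/\ker T\to Y$ be the mapping defined by $\tilde T([x])=T(x)$, where $X/\ker T$ carries the quasi-norm $\hat p$. Then the following hold: (1) $\tilde T$ is continuous. (2) $\|\tilde T\|_{\hat p,q}=\|T\|_{p,q}$. (3) If in addition $T$ is $p$-injective, open and $G$-injective, then $\tilde T$ is an isomorphism.
   Context: $\mathbb{R}^+$ is the set of nonnegative real numbers. A cone (on $\mathbb{R}^+$) is a triple $(X,+,\cdot)$ such that $(X,+)$ is an abelian monoid with neutral element $0$ and $\cdot:\mathbb{R}^+\times X\to X$ satisfies, for all $x,y\in X$ and $r,s\in\mathbb{R}^+$: $r\cdot(s\cdot x)=(rs)\cdot x$; $r\cdot(x+y)=r\cdot x+r\cdot y$; $(r+s)\cdot x=r\cdot x+s\cdot x$; $1\cdot x=x$; $0\cdot x=0$. It is cancellative if $z+x=z+y$ implies $x=y$. A subcone of $X$ is a subset which is a cone under the restricted operations. A linear mapping between cones is a mapping $f$ with $f(\alpha\cdot x+\beta\cdot y)=\alpha\cdot f(x)+\beta\cdot f(y)$ for all $x,y$ and $\alpha,\beta\in\mathbb{R}^+$. $-x$ denotes the additive inverse of $x$ when it exists. A quasi-norm on a cone $X$ is a function $q:X\to\mathbb{R}^+$ such that for all $x,y\in X$, $r\in\mathbb{R}^+$: (i) $x=0$ if and only if there is $-x\in X$ and $q(x)=q(-x)=0$;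 (ii) $q(r\cdot x)=rq(x)$; (iii) $q(x+y)\le q(x)+q(y)$. A quasi-normed cone is a pair $(X,p)$ where $X$ is a cancellative cone and $p$ is a quasi-norm on $X$. Its induced extended quasi-metric is $d_p(x,y)=p(a)$ if $y=x+a$ with $a\in X$, and $d_p(x,y)=+\infty$ if $y\notin x+X$. $\mathcal{T}(d_p)$ is the topology on $X$ with base the balls $\{y\in X: d_p(x,y)<r\}$, $x\in X$, $r>0$. Continuity and openness of mappings between quasi-normed cones $(X,p)$, $(Y,q)$ refer to $\mathcal{T}(d_p)$ and $\mathcal{T}(d_q)$. For a continuous linear $f:(X,p)\to(Y,q)$, $\|f\|_{p,q}=\sup\{q(f(x)): x\in X,\ p(x)\le 1\}$. An isomorphism is a continuous linear bijective mapping whose inverse is continuous. For a subcone $N$ of $X$, $G_N=\{y\in N: -y\in N\}$, $[x]=\{x+g: g\in G_N\}$, and $X/N=\{[x]: x\in X\}$ is the quotient cone with operations $[x]+[z]=[x+z]$, $\lambda\cdot[x]=[\lambda\cdot x]$ ($\lambda\in\mathbb{R}^+$). When $G_N$ is closed in $(X,\mathcal{T}(d_p))$, $X/N$ is a quasi-normed cone with the quasi-norm $\hat p([x])=\inf\{p(x+y): y\in G_N\}$. Here this is applied with $N=\ker T=\{x\in X: T(x)=0\}$; the mapping $\tilde T$ is well defined and linear. $T$ is $p$-injective if $T(x)=T(y)$ implies $p(x)=p(y)$ for all $x,y\in X$. $T$ is $G$-injective if $T(x)=T(y)$ implies $y\in[x]$ for all $x,y\in X$, where $[x]=\{x+g: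 g\in G_{\ker T}\}$. *)

theory Defs
  imports "HOL-Analysis.Analysis" "HOL-Algebra.Group"
begin

text \<open>
  Cones are carrier-based structures, since quotients are cones of cosets. The additive monoid of
  a cone is a \<open>monoid\<close> record of \<open>HOL-Algebra.Group\<close>, written additively below; thus \<open>Units X\<close> is
  the set of \<open>x\<close> for which \<open>-x\<close> exists, and \<open>m_inv X x\<close> is \<open>-x\<close>.
\<close>

record 'a cone = "'a monoid" +
  scale :: "real \<Rightarrow> 'a \<Rightarrow> 'a"  (infixr "\<odot>\<index>" 75)

notation monoid.mult  (infixl "\<oplus>\<index>" 65)
notation monoid.one  ("\<zero>\<index>")

text \<open>Scalars range over the nonnegative reals; \<open>scale\<close> is unconstrained at negative ones.\<close>

locale abstract_cone = Group.comm_monoid X for X :: "'a cone" (structure) +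
  assumes scale_closed: "\<lbrakk>r \<ge> 0; x \<in> carrier X\<rbrakk> \<Longrightarrow> r \<odot> x \<in> carrier X"
    and scale_scale: "\<lbrakk>r \<ge> 0; s \<ge> 0; x \<in> carrier X\<rbrakk> \<Longrightarrow> r \<odot> (s \<odot> x) = (r * s) \<odot> x"
    and scale_add: "\<lbrakk>r \<ge> 0; x \<in> carrier X; y \<in> carrier X\<rbrakk> \<Longrightarrow> r \<odot> (x \<oplus> y) = r \<odot> x \<oplus> r \<odot> y"
    and add_scale: "\<lbrakk>r \<ge> 0; s \<ge> 0; x \<in> carrier X\<rbrakk> \<Longrightarrow> (r + s) \<odot> x = r \<odot> x \<oplus> s \<odot> x"
    and scale_one: "x \<in> carrier X \<Longrightarrow> 1 \<odot> x = x"
    and scale_zero: "x \<in> carrier X \<Longrightarrow> 0 \<odot> x = \<zero>"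

locale cancellative_cone = abstract_cone +
  assumes cancel:
    "\<lbrakk>x \<in> carrier X; y \<in> carrier X; z \<in> carrier X; z \<oplus> x = z \<oplus> y\<rbrakk> \<Longrightarrow> x = y"

locale quasi_normed_cone = cancellative_cone +
  fixes p :: "'a \<Rightarrow> real"
  assumes qnorm_nonneg: "x \<in> carrier X \<Longrightarrow> p x \<ge> 0"
    and qnorm_eq_zero:
      "x \<in> carrier X \<Longrightarrow> x = \<zero> \<longleftrightarrow> x \<in> Units X \<and> p x = 0 \<and> p (m_inv X x) = 0"
    and qnorm_scale: "\<lbrakk>r \<ge> 0; x \<in> carrier X\<rbrakk> \<Longrightarrow> p (r \<odot> x) = r * p x"
    and qnorm_triangle: "\<lbrakk>x \<in> carrier X; y \<in> carrier X\<rbrakk> \<Longrightarrow> p (x \<oplus> y) \<le> p x + p y"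


definition qdist :: "'a cone \<Rightarrow> ('a \<Rightarrow> real) \<Rightarrow> 'a \<Rightarrow> 'a \<Rightarrow> ereal" where
  "qdist X p x y =
     (if \<exists>a\<in>carrier X. y = x \<oplus>\<^bsub>X\<^esub> a
      then ereal (p (THE a. a \<in> carrier X \<and> y = x \<oplus>\<^bsub>X\<^esub> a)) else \<infinity>)"

definition qball :: "'a cone \<Rightarrow> ('a \<Rightarrow> real) \<Rightarrow> 'a \<Rightarrow> real \<Rightarrow> 'a set" where
  "qball X p x r = {y \<in> carrier X. qdist X p x y < ereal r}"

text \<open>The open sets are the arbitrary unions of balls; \<open>istopology_qballs\<close> below shows that these
  form a topology.\<close>

definition qtopology :: "'a cone \<Rightarrow> ('a \<Rightarrow> real) \<Rightarrow> 'a topology" where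
  "qtopology X p =
     topology (arbitrary union_of (\<lambda>B. \<exists>x\<in>carrier X. \<exists>r>0. B = qball X p x r))"


definition cone_linear :: "'a cone \<Rightarrow> 'b cone \<Rightarrow> ('a \<Rightarrow> 'b) \<Rightarrow> bool" where
  "cone_linear X Y f \<longleftrightarrow> f \<in> carrier X \<rightarrow> carrier Y \<and>
     (\<forall>\<alpha>\<ge>0. \<forall>\<beta>\<ge>0. \<forall>x\<in>carrier X. \<forall>y\<in>carrier X.
        f (\<alpha> \<odot>\<^bsub>X\<^esub> x \<oplus>\<^bsub>X\<^esub> \<beta> \<odot>\<^bsub>X\<^esub> y) = \<alpha> \<odot>\<^bsub>Y\<^esub> f x \<oplus>\<^bsub>Y\<^esub> \<beta> \<odot>\<^bsub>Y\<^esub> f y)"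

text \<open>The supremum is taken in the extended reals, so that it is meaningful without a
  boundedness argument.\<close>

definition map_norm :: "'a cone \<Rightarrow> ('a \<Rightarrow> real) \<Rightarrow> ('b \<Rightarrow> real) \<Rightarrow> ('a \<Rightarrow> 'b) \<Rightarrow> ereal" where
  "map_norm X p q f = Sup {ereal (q (f x)) | x. x \<in> carrier X \<and> p x \<le> 1}"

definition cone_isomorphism ::
    "'a cone \<Rightarrow> ('a \<Rightarrow> real) \<Rightarrow> 'b cone \<Rightarrow> ('b \<Rightarrow> real) \<Rightarrow> ('a \<Rightarrow> 'b) \<Rightarrow> bool" where
  "cone_isomorphism X p Y q f \<longleftrightarrow>
     continuous_map (qtopology X p) (qtopology Y q) f \<and>
     cone_linear X Y f \<and>
     bij_betw f (carrier X) (carrier Y) \<and>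
     continuous_map (qtopology Y q) (qtopology X p) (inv_into (carrier X) f)"


definition cone_kernel :: "'a cone \<Rightarrow> 'b cone \<Rightarrow> ('a \<Rightarrow> 'b) \<Rightarrow> 'a set" where
  "cone_kernel X Y T = {x \<in> carrier X. T x = \<zero>\<^bsub>Y\<^esub>}"

definition inv_part :: "'a cone \<Rightarrow> 'a set \<Rightarrow> 'a set" where
  "inv_part X N = {y \<in> N. y \<in> Units X \<and> m_inv X y \<in> N}"

definition cone_class :: "'a cone \<Rightarrow> 'a set \<Rightarrow> 'a \<Rightarrow> 'a set" where
  "cone_class X N x = {x \<oplus>\<^bsub>X\<^esub> g | g. g \<in> inv_part X N}"

text \<open>For classes \<open>A\<close>, \<open>B\<close> all sets in the unions below coincide, so that \<open>[x] + [z] = [x + z]\<close>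
  and \<open>r \<cdot> [x] = [r \<cdot> x]\<close>; see \<open>quotient_add\<close> and \<open>quotient_scale\<close>. (The pointwise multiple of a
  class would not do: for \<open>r = 0\<close> it is \<open>{0}\<close>.)\<close>

definition quotient_cone :: "'a cone \<Rightarrow> 'a set \<Rightarrow> 'a set cone" where
  "quotient_cone X N =
     \<lparr>carrier = {cone_class X N x | x. x \<in> carrier X},
      mult = (\<lambda>A B. \<Union>a\<in>A. \<Union>b\<in>B. cone_class X N (a \<oplus>\<^bsub>X\<^esub> b)),
      one = cone_class X N \<zero>\<^bsub>X\<^esub>,
      scale = (\<lambda>r A. \<Union>a\<in>A. cone_class X N (r \<odot>\<^bsub>X\<^esub> a))\<rparr>"

text \<open>On a class \<open>A = [x]\<close> this is the infimum of \<open>p (x + y)\<close> over \<open>y\<close> in \<open>inv_part X N\<close>.\<close>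

definition quotient_norm :: "('a \<Rightarrow> real) \<Rightarrow> 'a set \<Rightarrow> real" where
  "quotient_norm p A = Inf {p a | a. a \<in> A}"

text \<open>The value at a class is the common value of \<open>T\<close> on its elements; see
  \<open>induced_map_class\<close>.\<close>

definition induced_map :: "('a \<Rightarrow> 'b) \<Rightarrow> 'a set \<Rightarrow> 'b" where
  "induced_map T A = the_elem (T ` A)"

definition p_injective :: "'a cone \<Rightarrow> ('a \<Rightarrow> real) \<Rightarrow> ('a \<Rightarrow> 'b) \<Rightarrow> bool" where
  "p_injective X p T \<longleftrightarrow> (\<forall>x\<in>carrier X. \<forall>y\<in>carrier X. T x = T y \<longrightarrow> p x = p y)"

definition G_injective :: "'a cone \<Rightarrow> 'b cone \<Rightarrow> ('a \<Rightarrow> 'b) \<Rightarrow> bool" where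
  "G_injective X Y T \<longleftrightarrow>
     (\<forall>x\<in>carrier X. \<forall>y\<in>carrier X. T x = T y \<longrightarrow> y \<in> cone_class X (cone_kernel X Y T) x)"


lemma (in quasi_normed_cone) qnorm_zero: "p \<zero> = 0"
  using qnorm_eq_zero[of \<zero>] by simp

lemma (in quasi_normed_cone) qdist_add:
  assumes "x \<in> carrier X" "a \<in> carrier X"
  shows "qdist X p x (x \<oplus> a) = ereal (p a)"
proof -
  have "(THE b. b \<in> carrier X \<and> x \<oplus> a = x \<oplus> b) = a"
    using assms cancel by (intro the_equality) blast+
  with assms show ?thesis unfolding qdist_def by auto
qed

lemma (in quasi_normed_cone) mem_qball_iff:
  assumes "x \<in> carrier X"
  shows "y \<in> qball X p x r \<longleftrightarrow> (\<exists>a\<in>carrier X. y = x \<oplus> a \<and> p a < r)"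
proof (cases "\<exists>a\<in>carrier X. y = x \<oplus> a")
  case True
  then obtain a where a: "a \<in> carrier X" "y = x \<oplus> a" by blast
  have "b = a" if "b \<in> carrier X" "y = x \<oplus> b" for b
    using cancel[of b a x] that a assms by simp
  then show ?thesis
    using a assms by (auto simp: qball_def qdist_add)
next
  case False
  then show ?thesis by (auto simp: qball_def qdist_def)
qed

lemma (in quasi_normed_cone) istopology_qballs:
  "istopology (arbitrary union_of (\<lambda>B. \<exists>x\<in>carrier X. \<exists>r>0. B = qball X p x r))"
proof (rule istopology_base_alt[THEN iffD2], intro allI impI, elim conjE)
  let ?P = "\<lambda>B. \<exists>x\<in>carrier X. \<exists>r>0. B = qball X p x r"
  fix S U
  assume S: "(arbitrary union_of ?P) S" and U: "(arbitrary union_of ?P) U"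
  have inner: "\<exists>r>0. qball X p z r \<subseteq> V" if V: "(arbitrary union_of ?P) V" and z: "z \<in> V" for V z
  proof -
    obtain B where B: "?P B" "z \<in> B" "B \<subseteq> V"
      using V z unfolding arbitrary_union_of_alt by meson
    then obtain x r where x: "x \<in> carrier X" and Beq: "B = qball X p x r" by blast
    obtain a where a: "a \<in> carrier X" "z = x \<oplus> a" "p a < r"
      using B(2) by (auto simp: Beq mem_qball_iff[OF x])
    have "qball X p z (r - p a) \<subseteq> B"
    proof
      fix y assume "y \<in> qball X p z (r - p a)"
      then obtain b where b: "b \<in> carrier X" "y = z \<oplus> b" "p b < r - p a"
        using mem_qball_iff[of z] a x by auto
      have "y = x \<oplus> (a \<oplus> b)" using a b x by (simp add: m_assoc)
      moreover have "p (a \<oplus> b) < r" using qnorm_triangle[of a b] a b by simp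
      ultimately show "y \<in> B" using a b by (auto simp: Beq mem_qball_iff[OF x])
    qed
    then show ?thesis using a B(3) by (intro exI[of _ "r - p a"]) auto
  qed
  have carr: "V \<subseteq> carrier X" if "(arbitrary union_of ?P) V" for V
    using that by (fastforce simp: arbitrary_union_of_alt qball_def)
  show "(arbitrary union_of ?P) (S \<inter> U)"
    unfolding arbitrary_union_of_alt
  proof
    fix z assume z: "z \<in> S \<inter> U"
    obtain r s where r: "r > 0" "qball X p z r \<subseteq> S" and s: "s > 0" "qball X p z s \<subseteq> U"
      using inner[OF S] inner[OF U] z by blast
    have zc: "z \<in> carrier X" using carr[OF S] z by blast
    have "qball X p z (min r s) \<subseteq> S \<inter> U"
    proof
      fix y assume "y \<in> qball X p z (min r s)"
      then have "y \<in> qball X p z r" "y \<in> qball X p z s"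
        by (auto simp: mem_qball_iff[OF zc])
      then show "y \<in> S \<inter> U" using r s by blast
    qed
    moreover have "z \<in> qball X p z (min r s)"
      using r s zc qnorm_zero by (auto simp: mem_qball_iff[OF zc] intro!: bexI[of _ \<zero>])
    ultimately show "\<exists>W. ?P W \<and> z \<in> W \<and> W \<subseteq> S \<inter> U"
      using zc r(1) s(1) by (metis min_less_iff_conj)
  qed
qed

lemma cone_linear_zero:
  assumes "abstract_cone X" "abstract_cone Y" "cone_linear X Y T"
  shows "T \<zero>\<^bsub>X\<^esub> = \<zero>\<^bsub>Y\<^esub>"
proof -
  interpret X: abstract_cone X by fact
  interpret Y: abstract_cone Y by fact
  have "T \<zero>\<^bsub>X\<^esub> \<in> carrier Y" using assms(3) by (auto simp: cone_linear_def)
  moreover have "T (0 \<odot>\<^bsub>X\<^esub> \<zero>\<^bsub>X\<^esub> \<oplus>\<^bsub>X\<^esub> 0 \<odot>\<^bsub>X\<^esub> \<zero>\<^bsub>X\<^esub>) = 0 \<odot>\<^bsub>Y\<^esub> T \<zero>\<^bsub>X\<^esub> \<oplus>\<^bsub>Y\<^esub> 0 \<odot>\<^bsub>Y\<^esub> T \<zero>\<^bsub>X\<^esub>"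
    using assms(3) unfolding cone_linear_def by fastforce
  ultimately show ?thesis by (simp add: X.scale_zero Y.scale_zero)
qed

lemma cone_linear_add:
  assumes "abstract_cone X" "abstract_cone Y" "cone_linear X Y T" "x \<in> carrier X" "y \<in> carrier X"
  shows "T (x \<oplus>\<^bsub>X\<^esub> y) = T x \<oplus>\<^bsub>Y\<^esub> T y"
proof -
  interpret X: abstract_cone X by fact
  interpret Y: abstract_cone Y by fact
  have "T x \<in> carrier Y" "T y \<in> carrier Y" using assms by (auto simp: cone_linear_def)
  moreover have "T (1 \<odot>\<^bsub>X\<^esub> x \<oplus>\<^bsub>X\<^esub> 1 \<odot>\<^bsub>X\<^esub> y) = 1 \<odot>\<^bsub>Y\<^esub> T x \<oplus>\<^bsub>Y\<^esub> 1 \<odot>\<^bsub>Y\<^esub> T y"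
    using assms(3-5) unfolding cone_linear_def by (metis zero_le_one)
  ultimately show ?thesis using assms by (simp add: X.scale_one Y.scale_one)
qed

lemma cone_linear_scale:
  assumes "abstract_cone X" "abstract_cone Y" "cone_linear X Y T" "x \<in> carrier X" "r \<ge> 0"
  shows "T (r \<odot>\<^bsub>X\<^esub> x) = r \<odot>\<^bsub>Y\<^esub> T x"
proof -
  interpret X: abstract_cone X by fact
  interpret Y: abstract_cone Y by fact
  have "T x \<in> carrier Y" using assms by (auto simp: cone_linear_def)
  moreover have "T (r \<odot>\<^bsub>X\<^esub> x \<oplus>\<^bsub>X\<^esub> 0 \<odot>\<^bsub>X\<^esub> x) = r \<odot>\<^bsub>Y\<^esub> T x \<oplus>\<^bsub>Y\<^esub> 0 \<odot>\<^bsub>Y\<^esub> T x"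
    using assms(3-5) unfolding cone_linear_def by (metis order_refl)
  ultimately show ?thesis
    using assms by (simp add: X.scale_zero Y.scale_zero X.scale_closed Y.scale_closed)
qed

locale cone_and_subcone = abstract_cone +
  fixes N
  assumes sub: "N \<subseteq> carrier X" and zero_mem: "\<zero> \<in> N"
    and add_mem: "\<lbrakk>x \<in> N; y \<in> N\<rbrakk> \<Longrightarrow> x \<oplus> y \<in> N"
    and scale_mem: "\<lbrakk>r \<ge> 0; x \<in> N\<rbrakk> \<Longrightarrow> r \<odot> x \<in> N"
begin

lemma inv_part_iff: "y \<in> inv_part X N \<longleftrightarrow> y \<in> N \<and> (\<exists>z\<in>N. y \<oplus> z = \<zero>)"
proof
  assume "y \<in> inv_part X N"
  then show "y \<in> N \<and> (\<exists>z\<in>N. y \<oplus> z = \<zero>)"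
    using Units_r_inv unfolding inv_part_def by blast
next
  assume "y \<in> N \<and> (\<exists>z\<in>N. y \<oplus> z = \<zero>)"
  then obtain z where z: "y \<in> N" "z \<in> N" "y \<oplus> z = \<zero>" by blast
  then have y: "y \<in> carrier X" and zc: "z \<in> carrier X" using sub by blast+
  then have yU: "y \<in> Units X" using z m_comm[of y z] unfolding Units_def by auto
  then have "m_inv X y = z" using inv_unique[of "m_inv X y" y z] z y zc by simp
  with yU z show "y \<in> inv_part X N" by (simp add: inv_part_def)
qed

lemma inv_part_zero: "\<zero> \<in> inv_part X N"
  using zero_mem by (auto simp: inv_part_iff intro!: bexI[of _ \<zero>])

lemma inv_part_closed: "g \<in> inv_part X N \<Longrightarrow> g \<in> carrier X"
  using sub by (auto simp: inv_part_iff)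

lemma inv_part_inverse: "g \<in> inv_part X N \<Longrightarrow> \<exists>h \<in> inv_part X N. g \<oplus> h = \<zero>"
proof -
  assume g: "g \<in> inv_part X N"
  then obtain z where z: "g \<in> N" "z \<in> N" "g \<oplus> z = \<zero>" by (auto simp: inv_part_iff)
  then have "z \<oplus> g = \<zero>" using m_comm[of g z] sub by (metis subsetD)
  then have "z \<in> inv_part X N" using z by (auto simp: inv_part_iff)
  with z(3) show "\<exists>h \<in> inv_part X N. g \<oplus> h = \<zero>" by (rule bexI)
qed

lemma inv_part_add:
  assumes "g \<in> inv_part X N" "h \<in> inv_part X N"
  shows "g \<oplus> h \<in> inv_part X N"
proof -
  obtain g' h' where *: "g' \<in> N" "h' \<in> N" "g \<oplus> g' = \<zero>" "h \<oplus> h' = \<zero>" "g \<in> N" "h \<in> N"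
    using assms by (auto simp: inv_part_iff)
  have "(g \<oplus> h) \<oplus> (g' \<oplus> h') = (g \<oplus> g') \<oplus> (h \<oplus> h')"
    using * sub by (simp add: subset_iff m_ac)
  then have "(g \<oplus> h) \<oplus> (g' \<oplus> h') = \<zero>" using * by simp
  then show ?thesis
    unfolding inv_part_iff using add_mem * by blast
qed

lemma inv_part_scale:
  assumes "g \<in> inv_part X N" "r \<ge> 0"
  shows "r \<odot> g \<in> inv_part X N"
proof -
  obtain g' where *: "g' \<in> N" "g \<oplus> g' = \<zero>" "g \<in> N"
    using assms by (auto simp: inv_part_iff)
  have "r \<odot> \<zero> = \<zero>"
    using assms scale_scale[of r 0 \<zero>] by (simp add: scale_zero)
  then have "r \<odot> g \<oplus> r \<odot> g' = \<zero>"
    using * sub assms by (metis scale_add subsetD)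
  then show ?thesis using * assms scale_mem unfolding inv_part_iff by blast
qed

lemma class_absorb:
  assumes "x \<in> carrier X" "g \<in> inv_part X N"
  shows "cone_class X N (x \<oplus> g) = cone_class X N x"
proof -
  have 1: "cone_class X N (y \<oplus> k) \<subseteq> cone_class X N y"
    if "y \<in> carrier X" "k \<in> inv_part X N" for y k
    using that inv_part_add inv_part_closed unfolding cone_class_def
    by (auto simp: m_assoc)
  obtain h where h: "h \<in> inv_part X N" "g \<oplus> h = \<zero>" using inv_part_inverse assms by blast
  then have "(x \<oplus> g) \<oplus> h = x" using assms inv_part_closed by (simp add: m_assoc)
  then show ?thesis
    using 1[of x g] 1[of "x \<oplus> g" h] assms h inv_part_closed by auto
qed

lemma class_self: "x \<in> carrier X \<Longrightarrow> x \<in> cone_class X N x"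
  using inv_part_zero unfolding cone_class_def by force

lemma quotient_add:
  assumes "x \<in> carrier X" "z \<in> carrier X"
  shows "cone_class X N x \<oplus>\<^bsub>quotient_cone X N\<^esub> cone_class X N z = cone_class X N (x \<oplus> z)"
proof -
  have "cone_class X N (a \<oplus> b) = cone_class X N (x \<oplus> z)"
    if ab: "a \<in> cone_class X N x" "b \<in> cone_class X N z" for a b
  proof -
    obtain g h where *: "g \<in> inv_part X N" "h \<in> inv_part X N" "a = x \<oplus> g" "b = z \<oplus> h"
      using ab by (auto simp: cone_class_def)
    then have "a \<oplus> b = (x \<oplus> z) \<oplus> (g \<oplus> h)"
      using assms inv_part_closed by (simp add: m_ac)
    then show ?thesis using class_absorb inv_part_add * assms by simp
  qed
  then have "(\<Union>b\<in>cone_class X N z. cone_class X N (a \<oplus> b)) = cone_class X N (x \<oplus> z)"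
    if "a \<in> cone_class X N x" for a
    using that class_self[OF assms(2)] by (intro UN_constant_eq[of z] ballI) blast+
  then have "(\<Union>a\<in>cone_class X N x. \<Union>b\<in>cone_class X N z. cone_class X N (a \<oplus> b)) =
      cone_class X N (x \<oplus> z)"
    by (intro UN_constant_eq[OF class_self[OF assms(1)]] ballI)
  then show ?thesis by (simp add: quotient_cone_def)
qed

lemma quotient_scale:
  assumes "x \<in> carrier X" "r \<ge> 0"
  shows "r \<odot>\<^bsub>quotient_cone X N\<^esub> cone_class X N x = cone_class X N (r \<odot> x)"
proof -
  have "cone_class X N (r \<odot> a) = cone_class X N (r \<odot> x)" if a: "a \<in> cone_class X N x" for a
  proof -
    obtain g where "g \<in> inv_part X N" "a = x \<oplus> g"
      using a by (auto simp: cone_class_def)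
    then show ?thesis
      using class_absorb[of "r \<odot> x" "r \<odot> g"] inv_part_scale inv_part_closed assms
      by (simp add: scale_add scale_closed)
  qed
  then have "(\<Union>a\<in>cone_class X N x. cone_class X N (r \<odot> a)) = cone_class X N (r \<odot> x)"
    using class_self[OF assms(1)] by (intro UN_constant_eq[of x] ballI) blast+
  then show ?thesis by (simp add: quotient_cone_def)
qed

end

lemma subcone_kernel:
  assumes "abstract_cone X" "abstract_cone Y" "cone_linear X Y T"
  shows "cone_and_subcone X (cone_kernel X Y T)"
proof -
  interpret X: abstract_cone X by fact
  interpret Y: abstract_cone Y by fact
  have s0: "r \<odot>\<^bsub>Y\<^esub> \<zero>\<^bsub>Y\<^esub> = \<zero>\<^bsub>Y\<^esub>" if "r \<ge> 0" for r
    using that Y.scale_scale[of r 0 "\<zero>\<^bsub>Y\<^esub>"] by (simp add: Y.scale_zero)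
  show ?thesis
    by unfold_locales
      (auto simp: cone_kernel_def cone_linear_zero[OF assms] cone_linear_add[OF assms]
        cone_linear_scale[OF assms] X.scale_closed s0)
qed

lemma induced_map_class:
  assumes "abstract_cone X" "abstract_cone Y" "cone_linear X Y T" "x \<in> carrier X"
  shows "induced_map T (cone_class X (cone_kernel X Y T) x) = T x"
proof -
  interpret Y: abstract_cone Y by fact
  interpret cone_and_subcone X "cone_kernel X Y T" by (rule subcone_kernel) fact+
  have Tx: "T x \<in> carrier Y" using assms by (auto simp: cone_linear_def)
  have "T a = T x" if "a \<in> cone_class X (cone_kernel X Y T) x" for a
    using that cone_linear_add[OF assms(1-3)] assms(4) Tx
    by (auto simp: cone_class_def inv_part_def cone_kernel_def)
  then have "T ` cone_class X (cone_kernel X Y T) x = {T x}"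
    using class_self[OF assms(4)] by blast
  then show ?thesis by (simp add: induced_map_def)
qed

end

theory Submission
  imports Defs
begin

text \<open>
  A linear map between quasi-normed cones is continuous iff it is continuous at zero, iff it is
  bounded. Since \<open>T\<close> is constant on classes modulo \<open>ker T\<close>, a bound \<open>q (T x) \<le> K p x\<close>
  passes to the infimum \<open>quotient_norm p\<close> over the class of \<open>x\<close>, with the same constant; this gives
  continuity and the equality of norms. Openness of \<open>T\<close> at zero says that small \<open>y\<close> have small
  preimages, which is continuity at zero of the inverse of the induced map.
\<close>

section \<open>The topology of a quasi-normed cone\<close>

context quasi_normed_cone
begin

text \<open>By the triangle inequality, a base ball of radius \<open>r\<close> around
  \<open>x\<close> that contains \<open>z = x \<oplus> a\<close> also contains the ball of radius
  \<open>r - p a\<close> centred at \<open>z\<close>. So openness can be tested with centred balls,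
  as in a metric space, although the distance is not symmetric.\<close>

lemma openin_qtopology:
  "openin (qtopology X p) U \<longleftrightarrow> U \<subseteq> carrier X \<and> (\<forall>z\<in>U. \<exists>r>0. qball X p z r \<subseteq> U)"
proof -
  let ?P = "\<lambda>B. \<exists>x\<in>carrier X. \<exists>r>0. B = qball X p x r"
  have open_iff: "openin (qtopology X p) U \<longleftrightarrow> (\<forall>z\<in>U. \<exists>B. ?P B \<and> z \<in> B \<and> B \<subseteq> U)"
    using istopology_qballs by (simp add: qtopology_def arbitrary_union_of_alt)
  show ?thesis
  proof
    assume U: "openin (qtopology X p) U"
    have "\<exists>r>0. qball X p z r \<subseteq> U" if z: "z \<in> U" for z
    proof -
      obtain B where B: "?P B" "z \<in> B" "B \<subseteq> U"
        using U z unfolding open_iff by meson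
      then obtain x r where x: "x \<in> carrier X" and Beq: "B = qball X p x r" by blast
      obtain a where a: "a \<in> carrier X" "z = x \<oplus> a" "p a < r"
        using B(2) by (auto simp: Beq mem_qball_iff[OF x])
      have "qball X p z (r - p a) \<subseteq> B"
      proof
        fix y assume "y \<in> qball X p z (r - p a)"
        then obtain b where b: "b \<in> carrier X" "y = z \<oplus> b" "p b < r - p a"
          using mem_qball_iff[of z] a x by auto
        have "y = x \<oplus> (a \<oplus> b)" using a b x by (simp add: m_assoc)
        moreover have "p (a \<oplus> b) < r" using qnorm_triangle[of a b] a b by simp
        ultimately show "y \<in> B" using a b by (auto simp: Beq mem_qball_iff[OF x])
      qed
      then show ?thesis using a B(3) by (intro exI[of _ "r - p a"]) auto
    qed
    moreover have "U \<subseteq> carrier X"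
      using U unfolding open_iff qball_def by blast
    ultimately show "U \<subseteq> carrier X \<and> (\<forall>z\<in>U. \<exists>r>0. qball X p z r \<subseteq> U)" by blast
  next
    assume U: "U \<subseteq> carrier X \<and> (\<forall>z\<in>U. \<exists>r>0. qball X p z r \<subseteq> U)"
    show "openin (qtopology X p) U"
      unfolding open_iff
    proof
      fix z assume z: "z \<in> U"
      with U obtain r where r: "r > 0" "qball X p z r \<subseteq> U" and zc: "z \<in> carrier X" by blast
      have "z \<in> qball X p z r"
        using r zc qnorm_zero by (auto simp: mem_qball_iff intro!: bexI[of _ \<zero>])
      then show "\<exists>B. ?P B \<and> z \<in> B \<and> B \<subseteq> U" using r zc by blast
    qed
  qed
qed

lemma topspace_qtopology: "topspace (qtopology X p) = carrier X"
proof
  show "topspace (qtopology X p) \<subseteq> carrier X"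
    using openin_topspace[of "qtopology X p"] unfolding openin_qtopology by blast
  have "openin (qtopology X p) (carrier X)"
    unfolding openin_qtopology by (auto simp: qball_def intro: exI[of _ 1])
  then show "carrier X \<subseteq> topspace (qtopology X p)"
    by (rule openin_subset)
qed

lemma mem_qball_zero_iff: "x \<in> qball X p \<zero> r \<longleftrightarrow> x \<in> carrier X \<and> p x < r"
  by (auto simp: mem_qball_iff)

lemma openin_qball: "x \<in> carrier X \<Longrightarrow> r > 0 \<Longrightarrow> openin (qtopology X p) (qball X p x r)"
  unfolding qtopology_def topology_inverse'[OF istopology_qballs]
  by (rule arbitrary_union_of_inc) blast

end

section \<open>Continuity, boundedness and the norm of linear maps\<close>

locale quasi_normed_cone_linear =
  X: quasi_normed_cone X p + Y: quasi_normed_cone Y q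
  for X :: "'a cone" and p and Y :: "'b cone" and q +
  fixes T :: "'a \<Rightarrow> 'b"
  assumes linear: "cone_linear X Y T"
begin

lemmas map_zero = cone_linear_zero[OF X.abstract_cone_axioms Y.abstract_cone_axioms linear]
  and map_add = cone_linear_add[OF X.abstract_cone_axioms Y.abstract_cone_axioms linear]
  and map_scale = cone_linear_scale[OF X.abstract_cone_axioms Y.abstract_cone_axioms linear]

lemma map_closed: "x \<in> carrier X \<Longrightarrow> T x \<in> carrier Y"
  using linear by (auto simp: cone_linear_def)

text \<open>The ball around \<open>z\<close> consists of the points \<open>z \<oplus> a\<close> with
  \<open>p a\<close> small, so it is a translate of the ball at zero. Additivity of \<open>T\<close>
  carries the estimate at zero to \<open>z\<close> without any subtraction.\<close>

lemma continuous_if_at_zero: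
  assumes "\<And>e. e > 0 \<Longrightarrow> \<exists>d>0. \<forall>x\<in>carrier X. p x < d \<longrightarrow> q (T x) < e"
  shows "continuous_map (qtopology X p) (qtopology Y q) T"
  unfolding continuous_map_def X.topspace_qtopology Y.topspace_qtopology
proof (intro conjI allI impI)
  show "T \<in> carrier X \<rightarrow> carrier Y" using map_closed by blast
next
  fix V assume V: "openin (qtopology Y q) V"
  show "openin (qtopology X p) {x \<in> carrier X. T x \<in> V}"
    unfolding X.openin_qtopology
  proof (intro conjI ballI)
    fix z assume z: "z \<in> {x \<in> carrier X. T x \<in> V}"
    then obtain e where e: "e > 0" "qball Y q (T z) e \<subseteq> V"
      using V by (auto simp: Y.openin_qtopology)
    obtain d where d: "d > 0" "\<And>x. x \<in> carrier X \<Longrightarrow> p x < d \<Longrightarrow> q (T x) < e"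
      using assms e(1) by blast
    have "qball X p z d \<subseteq> {x \<in> carrier X. T x \<in> V}"
    proof
      fix y assume "y \<in> qball X p z d"
      then obtain a where a: "a \<in> carrier X" "y = z \<oplus>\<^bsub>X\<^esub> a" "p a < d"
        using z by (auto simp: X.mem_qball_iff)
      then have "T y \<in> qball Y q (T z) e"
        using d z map_closed by (auto simp: Y.mem_qball_iff map_add)
      then show "y \<in> {x \<in> carrier X. T x \<in> V}" using a z e(2) by auto
    qed
    then show "\<exists>r>0. qball X p z r \<subseteq> {x \<in> carrier X. T x \<in> V}" using d(1) by blast
  qed auto
qed

lemma continuous_if_bounded:
  assumes "\<And>x. x \<in> carrier X \<Longrightarrow> q (T x) \<le> K * p x"
  shows "continuous_map (qtopology X p) (qtopology Y q) T"
proof (rule continuous_if_at_zero)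
  fix e :: real assume e: "e > 0"
  \<comment> \<open>The sign of \<open>K\<close> is unknown; \<open>\<bar>K\<bar> + 1\<close> is a
    larger constant by which one may divide.\<close>
  have "q (T x) < e" if x: "x \<in> carrier X" "p x < e / (\<bar>K\<bar> + 1)" for x
  proof -
    have "q (T x) \<le> (\<bar>K\<bar> + 1) * p x"
      using assms[OF x(1)] mult_right_mono[OF _ X.qnorm_nonneg[OF x(1)], of K "\<bar>K\<bar> + 1"]
      by linarith
    also have "\<dots> < e" using x(2) by (simp add: pos_less_divide_eq mult.commute)
    finally show ?thesis .
  qed
  then show "\<exists>d>0. \<forall>x\<in>carrier X. p x < d \<longrightarrow> q (T x) < e"
    using e by (intro exI[of _ "e / (\<bar>K\<bar> + 1)"]) auto
qed

text \<open>The preimage of the unit ball at zero contains a ball of some radius \<open>d\<close>,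
  and homogeneity turns this into a bound with constant \<open>1 / d\<close>.\<close>

lemma bounded_if_continuous:
  assumes cont: "continuous_map (qtopology X p) (qtopology Y q) T"
  obtains K where "\<And>x. x \<in> carrier X \<Longrightarrow> q (T x) \<le> K * p x"
proof -
  have "openin (qtopology Y q) (qball Y q \<zero>\<^bsub>Y\<^esub> 1)" by (simp add: Y.openin_qball)
  then have "openin (qtopology X p) {x \<in> carrier X. T x \<in> qball Y q \<zero>\<^bsub>Y\<^esub> 1}"
    using cont by (simp add: continuous_map_def X.topspace_qtopology)
  moreover have "\<zero>\<^bsub>X\<^esub> \<in> {x \<in> carrier X. T x \<in> qball Y q \<zero>\<^bsub>Y\<^esub> 1}"
    by (simp add: map_zero Y.mem_qball_zero_iff Y.qnorm_zero)
  ultimately obtain d where d: "d > 0"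
    and "qball X p \<zero>\<^bsub>X\<^esub> d \<subseteq> {x \<in> carrier X. T x \<in> qball Y q \<zero>\<^bsub>Y\<^esub> 1}"
    unfolding X.openin_qtopology by blast
  then have less: "q (T x) < 1" if "x \<in> carrier X" "p x < d" for x
    using that by (auto simp: X.mem_qball_zero_iff Y.mem_qball_zero_iff)
  have "q (T x) \<le> 1 / d * p x" if x: "x \<in> carrier X" for x
  proof (rule ccontr)
    assume *: "\<not> q (T x) \<le> 1 / d * p x"
    then have "d * q (T x) > p x" using d by (simp add: field_simps)
    moreover have pos: "q (T x) > 0"
      using * d X.qnorm_nonneg[OF x] by (smt (verit) divide_nonneg_pos mult_nonneg_nonneg)
    \<comment> \<open>Normalising by \<open>q (T x)\<close> rather than by \<open>p x\<close> also
      covers \<open>p x = 0\<close>. The rescaled element lies in the ball of radius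
      \<open>d\<close>, yet its image has quasi-norm exactly 1.\<close>
    ultimately have "p ((1 / q (T x)) \<odot>\<^bsub>X\<^esub> x) < d"
      using x by (simp add: X.qnorm_scale pos_divide_less_eq)
    then have "q (T ((1 / q (T x)) \<odot>\<^bsub>X\<^esub> x)) < 1"
      using less[of "(1 / q (T x)) \<odot>\<^bsub>X\<^esub> x"] x pos by (simp add: X.scale_closed)
    then show False
      using x pos map_closed[OF x] by (simp add: map_scale Y.qnorm_scale)
  qed
  then show thesis by (rule that)
qed

text \<open>If \<open>p x > 0\<close>, rescaling \<open>x\<close> to quasi-norm 1 brings it under
  the supremum. A nonzero \<open>x\<close> may have \<open>p x = 0\<close>; there rescaling is
  impossible and the bound \<open>K\<close> yields \<open>q (T x) \<le> 0\<close>.\<close>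

lemma le_map_norm_mult:
  assumes K: "\<And>x. x \<in> carrier X \<Longrightarrow> q (T x) \<le> K * p x"
    and M: "map_norm X p q T \<le> ereal M" and x: "x \<in> carrier X"
  shows "q (T x) \<le> M * p x"
proof (cases "p x = 0")
  case True
  then show ?thesis using K[OF x] by simp
next
  case False
  then have pos: "p x > 0" using X.qnorm_nonneg[OF x] by simp
  let ?z = "(1 / p x) \<odot>\<^bsub>X\<^esub> x"
  have "?z \<in> carrier X" "p ?z \<le> 1"
    using pos x by (simp_all add: X.scale_closed X.qnorm_scale)
  then have "ereal (q (T ?z)) \<le> map_norm X p q T"
    unfolding map_norm_def by (intro Sup_upper) blast
  then have "ereal (q (T ?z)) \<le> ereal M" using M by (rule order_trans)
  then show ?thesis
    using pos x map_closed[OF x] by (simp add: map_scale Y.qnorm_scale field_simps)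
qed

lemma map_norm_leI:
  assumes "\<And>x. x \<in> carrier X \<Longrightarrow> q (T x) \<le> M * p x" and "M \<ge> 0"
  shows "map_norm X p q T \<le> ereal M"
  unfolding map_norm_def
proof (rule Sup_least, clarify)
  fix x assume "x \<in> carrier X" "p x \<le> 1"
  then show "ereal (q (T x)) \<le> ereal M"
    using assms(1)[of x] mult_left_mono[of "p x" 1 M] assms(2) by simp
qed

text \<open>The zero element contributes the value 0 to the supremum. This excludes -\<infinity>
  when the norm is to be read as a real number.\<close>

lemma map_norm_nonneg: "0 \<le> map_norm X p q T"
proof -
  have "ereal (q (T \<zero>\<^bsub>X\<^esub>)) \<le> map_norm X p q T"
    unfolding map_norm_def
    by (intro Sup_upper) (auto simp: X.qnorm_zero intro!: exI[of _ "\<zero>\<^bsub>X\<^esub>"])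
  then show ?thesis by (simp add: map_zero Y.qnorm_zero zero_ereal_def)
qed

end

section \<open>Algebra of the quotient cone\<close>

context cone_and_subcone
begin

lemma class_eq_iff:
  assumes "x \<in> carrier X" "y \<in> carrier X"
  shows "cone_class X N x = cone_class X N y \<longleftrightarrow> x \<in> cone_class X N y"
proof
  assume "x \<in> cone_class X N y"
  then show "cone_class X N x = cone_class X N y"
    using class_absorb[OF assms(2)] by (auto simp: cone_class_def[of X N y])
qed (use class_self[OF assms(1)] in blast)

lemma class_closed: "x \<in> carrier X \<Longrightarrow> a \<in> cone_class X N x \<Longrightarrow> a \<in> carrier X"
  using inv_part_closed by (auto simp: cone_class_def)

lemma quotient_carrierE:
  assumes "A \<in> carrier (quotient_cone X N)"
  obtains x where "x \<in> carrier X" "A = cone_class X N x"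
  using assms by (auto simp: quotient_cone_def)

lemma class_in_quotient: "x \<in> carrier X \<Longrightarrow> cone_class X N x \<in> carrier (quotient_cone X N)"
  by (auto simp: quotient_cone_def)

lemma quotient_zero: "\<zero>\<^bsub>quotient_cone X N\<^esub> = cone_class X N \<zero>"
  by (simp add: quotient_cone_def)

lemmas quotient_simps = class_in_quotient quotient_zero quotient_add quotient_scale scale_closed

text \<open>Every class has a representative, and \<open>quotient_add\<close> and
  \<open>quotient_scale\<close> compute on representatives, so each cone axiom reduces to its
  counterpart in \<open>X\<close>.\<close>

lemma abstract_cone_quotient: "abstract_cone (quotient_cone X N)"
  by unfold_locales
    (auto elim!: quotient_carrierE simp: quotient_simps m_ac scale_scale scale_add add_scale
      scale_one scale_zero)

lemma class_zero: "cone_class X N \<zero> = inv_part X N"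
  using inv_part_closed by (force simp: cone_class_def)

end

section \<open>Cancellation in the quotient and the quotient quasi-norm\<close>

locale quasi_normed_cone_and_subcone =
  quasi_normed_cone X p + cone_and_subcone X N for X :: "'a cone" (structure) and p and N
begin

lemma cancellative_cone_quotient: "cancellative_cone (quotient_cone X N)"
proof -
  interpret Q: abstract_cone "quotient_cone X N" by (rule abstract_cone_quotient)
  show ?thesis
  proof unfold_locales
    fix A B C
    assume "A \<in> carrier (quotient_cone X N)" "B \<in> carrier (quotient_cone X N)"
      "C \<in> carrier (quotient_cone X N)"
      and eq: "C \<oplus>\<^bsub>quotient_cone X N\<^esub> A = C \<oplus>\<^bsub>quotient_cone X N\<^esub> B"
    then obtain x y z where *: "x \<in> carrier X" "A = cone_class X N x" "y \<in> carrier X"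
      "B = cone_class X N y" "z \<in> carrier X" "C = cone_class X N z"
      by (metis quotient_carrierE)
    then have "z \<oplus> x \<in> cone_class X N (z \<oplus> y)"
      using eq by (simp add: quotient_simps class_eq_iff)
    then obtain g where g: "g \<in> inv_part X N" "z \<oplus> x = (z \<oplus> y) \<oplus> g"
      by (auto simp: cone_class_def)
    \<comment> \<open>Cancelling \<open>z\<close> in \<open>X\<close> keeps the invertible summand
      \<open>g\<close>, which disappears on passing to classes.\<close>
    then have "x = y \<oplus> g"
      using * inv_part_closed cancel[of x "y \<oplus> g" z] by (simp add: m_assoc)
    then show "A = B" using * g class_absorb by simp
  qed
qed

text \<open>A class is nonempty and \<open>p\<close> is bounded below by 0 on it, so the real
  infimum is a genuine one. The order facts about the quotient quasi-norm below all rest on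
  this.\<close>

lemma quotient_norm_less_iff:
  assumes "x \<in> carrier X"
  shows "quotient_norm p (cone_class X N x) < r \<longleftrightarrow> (\<exists>a\<in>cone_class X N x. p a < r)"
proof -
  have "bdd_below {p a | a. a \<in> cone_class X N x}"
    using class_closed[OF assms] by (intro bdd_belowI[of _ 0]) (auto simp: qnorm_nonneg)
  then show ?thesis
    using class_self[OF assms] unfolding quotient_norm_def by (subst cInf_less_iff) auto
qed

lemma quotient_norm_le:
  "x \<in> carrier X \<Longrightarrow> a \<in> cone_class X N x \<Longrightarrow> quotient_norm p (cone_class X N x) \<le> p a"
  using quotient_norm_less_iff[of x "quotient_norm p (cone_class X N x)"]
  by (meson less_irrefl not_le)

lemma quotient_norm_greatest:
  "x \<in> carrier X \<Longrightarrow> (\<And>a. a \<in> cone_class X N x \<Longrightarrow> r \<le> p a) \<Longrightarrow>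
    r \<le> quotient_norm p (cone_class X N x)"
  using quotient_norm_less_iff[of x r] by (meson not_le)

lemma quotient_norm_nonneg: "x \<in> carrier X \<Longrightarrow> 0 \<le> quotient_norm p (cone_class X N x)"
  by (rule quotient_norm_greatest) (auto intro: qnorm_nonneg class_closed)

lemma quotient_norm_zero: "quotient_norm p (cone_class X N \<zero>) = 0"
  using quotient_norm_le[of \<zero> \<zero>] quotient_norm_nonneg[of \<zero>] class_self[of \<zero>]
  by (simp add: qnorm_zero)

lemma quotient_norm_triangle:
  assumes "x \<in> carrier X" "y \<in> carrier X"
  shows "quotient_norm p (cone_class X N (x \<oplus> y))
    \<le> quotient_norm p (cone_class X N x) + quotient_norm p (cone_class X N y)"
proof -
  have "quotient_norm p (cone_class X N (x \<oplus> y)) \<le> p a + p b"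
    if ab: "a \<in> cone_class X N x" "b \<in> cone_class X N y" for a b
  proof -
    obtain g h where *: "g \<in> inv_part X N" "h \<in> inv_part X N" "a = x \<oplus> g" "b = y \<oplus> h"
      using ab by (auto simp: cone_class_def)
    then have "a \<oplus> b = (x \<oplus> y) \<oplus> (g \<oplus> h)"
      using assms inv_part_closed by (simp add: m_ac)
    then have "a \<oplus> b \<in> cone_class X N (x \<oplus> y)"
      using * inv_part_add by (auto simp: cone_class_def)
    then have "quotient_norm p (cone_class X N (x \<oplus> y)) \<le> p (a \<oplus> b)"
      using assms by (simp add: quotient_norm_le)
    also have "\<dots> \<le> p a + p b" using ab assms class_closed by (simp add: qnorm_triangle)
    finally show ?thesis .
  qed
  \<comment> \<open>The infimum is taken over one summand at a time: first over \<open>a\<close>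
    with \<open>b\<close> fixed, then over \<open>b\<close>.\<close>
  then have "quotient_norm p (cone_class X N (x \<oplus> y)) - p b \<le> quotient_norm p (cone_class X N x)"
    if "b \<in> cone_class X N y" for b
    using that by (intro quotient_norm_greatest[OF assms(1)]) (simp add: algebra_simps)
  then have "quotient_norm p (cone_class X N (x \<oplus> y)) - quotient_norm p (cone_class X N x)
      \<le> quotient_norm p (cone_class X N y)"
    by (intro quotient_norm_greatest[OF assms(2)]) (simp add: algebra_simps)
  then show ?thesis by simp
qed

lemma quotient_norm_scale:
  assumes x: "x \<in> carrier X" and "r \<ge> 0"
  shows "quotient_norm p (cone_class X N (r \<odot> x)) = r * quotient_norm p (cone_class X N x)"
proof (cases "r = 0")
  case True
  then show ?thesis using x by (simp add: scale_zero quotient_norm_zero)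
next
  case False
  \<comment> \<open>One inequality for all positive scalars suffices: the converse for
    \<open>r\<close> is the same inequality for the scalar \<open>1 / r\<close> and the element
    \<open>r \<odot> x\<close>. The scalar 0 has no inverse and was treated apart.\<close>
  have le: "quotient_norm p (cone_class X N (s \<odot> y)) \<le> s * quotient_norm p (cone_class X N y)"
    if y: "y \<in> carrier X" and s: "s > 0" for s y
  proof -
    have "quotient_norm p (cone_class X N (s \<odot> y)) / s \<le> p a" if a: "a \<in> cone_class X N y" for a
    proof -
      have "s \<odot> a \<in> cone_class X N (s \<odot> y)"
        using a y s inv_part_scale inv_part_closed by (force simp: cone_class_def scale_add)
      then have "quotient_norm p (cone_class X N (s \<odot> y)) \<le> p (s \<odot> a)"
        using y s by (simp add: quotient_norm_le scale_closed)
      then show ?thesis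
        using s qnorm_scale[of s a] class_closed[OF y a] by (simp add: field_simps)
    qed
    then have "quotient_norm p (cone_class X N (s \<odot> y)) / s \<le> quotient_norm p (cone_class X N y)"
      by (rule quotient_norm_greatest[OF y])
    then show ?thesis using s by (simp add: field_simps)
  qed
  have r: "r > 0" using False assms by simp
  have "(1 / r) \<odot> (r \<odot> x) = x" using x r by (simp add: scale_scale scale_one)
  then have "quotient_norm p (cone_class X N x) \<le> 1 / r * quotient_norm p (cone_class X N (r \<odot> x))"
    using le[of "r \<odot> x" "1 / r"] x r by (simp add: scale_closed)
  then show ?thesis using le[OF x r] r by (simp add: field_simps)
qed

text \<open>Definiteness is where closedness enters: if \<open>x\<close> were outside \<open>inv_part X N\<close>, a ball
  around \<open>x\<close> would miss \<open>inv_part X N\<close>, although small elements \<open>-x + g\<close> of the class of \<open>-x\<close>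
  translate \<open>x\<close> into it.\<close>

lemma quasi_normed_cone_quotient:
  assumes closed: "closedin (qtopology X p) (inv_part X N)"
  shows "quasi_normed_cone (quotient_cone X N) (quotient_norm p)"
proof -
  interpret Q: cancellative_cone "quotient_cone X N" by (rule cancellative_cone_quotient)
  have definite: "A = \<zero>\<^bsub>quotient_cone X N\<^esub>"
    if A: "A \<in> Units (quotient_cone X N)"
      and inv0: "quotient_norm p (m_inv (quotient_cone X N) A) = 0" for A
  proof (rule ccontr)
    assume A0: "A \<noteq> \<zero>\<^bsub>quotient_cone X N\<^esub>"
    obtain x where x: "x \<in> carrier X" "A = cone_class X N x"
      using Q.Units_closed[OF A] by (rule quotient_carrierE)
    obtain y where y: "y \<in> carrier X" "m_inv (quotient_cone X N) A = cone_class X N y"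
      using Q.Units_inv_closed[OF A] by (rule quotient_carrierE)
    have "cone_class X N (x \<oplus> y) = cone_class X N \<zero>"
      using Q.Units_r_inv[OF A] x y by (simp add: quotient_simps)
    \<comment> \<open>\<open>y\<close> represents the inverse class, so \<open>x \<oplus> y\<close>
      lies in the zero class, which is \<open>inv_part X N\<close> itself.\<close>
    then have xy: "x \<oplus> y \<in> inv_part X N"
      using x y class_self[of "x \<oplus> y"] by (simp add: class_zero)
    have "x \<notin> inv_part X N"
      using A0 x class_absorb[of \<zero> x] by (auto simp: quotient_zero)
    then obtain r where r: "r > 0" "qball X p x r \<subseteq> carrier X - inv_part X N"
      using closed x(1) unfolding closedin_def openin_qtopology topspace_qtopology by blast
    obtain a where a: "a \<in> cone_class X N y" "p a < r"
      using quotient_norm_less_iff[OF y(1), of r] inv0 y(2) r(1) by auto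
    then obtain g where g: "g \<in> inv_part X N" "a = y \<oplus> g" by (auto simp: cone_class_def)
    have "x \<oplus> a = (x \<oplus> y) \<oplus> g" using g x y inv_part_closed by (simp add: m_assoc)
    then have "x \<oplus> a \<in> inv_part X N" using xy g inv_part_add by simp
    moreover have "x \<oplus> a \<in> qball X p x r"
      using a x class_closed[OF y(1)] by (auto simp: mem_qball_iff)
    ultimately show False using r by blast
  qed
  have norm_zero: "quotient_norm p \<zero>\<^bsub>quotient_cone X N\<^esub> = 0"
    by (simp add: quotient_zero quotient_norm_zero)
  show ?thesis
  proof unfold_locales
    fix A assume A: "A \<in> carrier (quotient_cone X N)"
    then show "quotient_norm p A \<ge> 0" by (auto elim!: quotient_carrierE simp: quotient_norm_nonneg)
    show "A = \<zero>\<^bsub>quotient_cone X N\<^esub> \<longleftrightarrow> A \<in> Units (quotient_cone X N) \<and>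
        quotient_norm p A = 0 \<and> quotient_norm p (m_inv (quotient_cone X N) A) = 0"
      using definite norm_zero by auto
    fix r :: real assume "r \<ge> 0"
    then show "quotient_norm p (r \<odot>\<^bsub>quotient_cone X N\<^esub> A) = r * quotient_norm p A"
      using A by (auto elim!: quotient_carrierE simp: quotient_simps quotient_norm_scale)
  next
    fix A B assume "A \<in> carrier (quotient_cone X N)" "B \<in> carrier (quotient_cone X N)"
    then show "quotient_norm p (A \<oplus>\<^bsub>quotient_cone X N\<^esub> B) \<le> quotient_norm p A + quotient_norm p B"
      by (auto elim!: quotient_carrierE simp: quotient_simps quotient_norm_triangle)
  qed
qed

end

section \<open>Linearity of the induced map and of inverse maps\<close>

lemma (in cone_and_subcone) cone_linear_quotient:
  assumes f: "\<And>x. x \<in> carrier X \<Longrightarrow> f (cone_class X N x) = T x" and T: "cone_linear X Y T"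
  shows "cone_linear (quotient_cone X N) Y f"
  unfolding cone_linear_def
proof (intro conjI allI impI ballI)
  show "f \<in> carrier (quotient_cone X N) \<rightarrow> carrier Y"
    using T by (auto simp: f cone_linear_def elim!: quotient_carrierE)
next
  fix a b :: real and A B
  assume "a \<ge> 0" "b \<ge> 0" "A \<in> carrier (quotient_cone X N)" "B \<in> carrier (quotient_cone X N)"
  then show "f (a \<odot>\<^bsub>quotient_cone X N\<^esub> A \<oplus>\<^bsub>quotient_cone X N\<^esub> b \<odot>\<^bsub>quotient_cone X N\<^esub> B)
      = a \<odot>\<^bsub>Y\<^esub> f A \<oplus>\<^bsub>Y\<^esub> b \<odot>\<^bsub>Y\<^esub> f B"
    using T by (auto elim!: quotient_carrierE simp: f quotient_simps cone_linear_def)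
qed

text \<open>Applying \<open>f\<close> to the combination of the preimages gives the wanted
  combination in \<open>Y\<close>; injectivity then identifies it as the preimage.\<close>

lemma cone_linear_inv_into:
  assumes "abstract_cone X" "cone_linear X Y f" "bij_betw f (carrier X) (carrier Y)"
  shows "cone_linear Y X (inv_into (carrier X) f)"
  unfolding cone_linear_def
proof (intro conjI allI impI ballI)
  interpret X: abstract_cone X by fact
  let ?g = "inv_into (carrier X) f"
  have g: "?g y \<in> carrier X" "f (?g y) = y" if "y \<in> carrier Y" for y
    using that assms(3) by (auto simp: bij_betw_def inv_into_into f_inv_into_f)
  then show "?g \<in> carrier Y \<rightarrow> carrier X" by blast
  fix a b :: real and x y
  assume *: "a \<ge> 0" "b \<ge> 0" "x \<in> carrier Y" "y \<in> carrier Y"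
  have "f (a \<odot>\<^bsub>X\<^esub> ?g x \<oplus>\<^bsub>X\<^esub> b \<odot>\<^bsub>X\<^esub> ?g y) = a \<odot>\<^bsub>Y\<^esub> f (?g x) \<oplus>\<^bsub>Y\<^esub> b \<odot>\<^bsub>Y\<^esub> f (?g y)"
    using assms(2) * g unfolding cone_linear_def by blast
  then have "f (a \<odot>\<^bsub>X\<^esub> ?g x \<oplus>\<^bsub>X\<^esub> b \<odot>\<^bsub>X\<^esub> ?g y) = a \<odot>\<^bsub>Y\<^esub> x \<oplus>\<^bsub>Y\<^esub> b \<odot>\<^bsub>Y\<^esub> y"
    using * g by simp
  then show "?g (a \<odot>\<^bsub>Y\<^esub> x \<oplus>\<^bsub>Y\<^esub> b \<odot>\<^bsub>Y\<^esub> y) = a \<odot>\<^bsub>X\<^esub> ?g x \<oplus>\<^bsub>X\<^esub> b \<odot>\<^bsub>X\<^esub> ?g y"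
    using * g assms(3) X.scale_closed by (intro inv_into_f_eq) (auto simp: bij_betw_def)
qed

section \<open>The map induced on the quotient by the kernel\<close>

theorem proposition38:
  fixes X :: "'a cone" and p :: "'a \<Rightarrow> real"
    and Y :: "'b cone" and q :: "'b \<Rightarrow> real"
    and T :: "'a \<Rightarrow> 'b"
  assumes "quasi_normed_cone X p" and "quasi_normed_cone Y q"
    and "cone_linear X Y T"
    and "T ` carrier X = carrier Y"
    and "continuous_map (qtopology X p) (qtopology Y q) T"
    and "closedin (qtopology X p) (inv_part X (cone_kernel X Y T))"
  shows "continuous_map (qtopology (quotient_cone X (cone_kernel X Y T)) (quotient_norm p))
           (qtopology Y q) (induced_map T) \<and>
         map_norm (quotient_cone X (cone_kernel X Y T)) (quotient_norm p) q (induced_map T)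
           = map_norm X p q T \<and>
         (p_injective X p T \<and> open_map (qtopology X p) (qtopology Y q) T \<and> G_injective X Y T \<longrightarrow>
           cone_isomorphism (quotient_cone X (cone_kernel X Y T)) (quotient_norm p) Y q
             (induced_map T))"
proof -
  let ?N = "cone_kernel X Y T"
  let ?Q = "quotient_cone X ?N" and ?p = "quotient_norm p" and ?T = "induced_map T"
  interpret T: quasi_normed_cone_linear X p Y q T
    using assms(1-3) by (simp add: quasi_normed_cone_linear_def quasi_normed_cone_linear_axioms_def)
  interpret N: cone_and_subcone X ?N
    using assms(3) by (rule subcone_kernel[OF T.X.abstract_cone_axioms T.Y.abstract_cone_axioms])
  interpret XN: quasi_normed_cone_and_subcone X p ?N ..
  have ind: "?T (cone_class X ?N x) = T x" if "x \<in> carrier X" for x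
    using that assms(3)
    by (rule induced_map_class[OF T.X.abstract_cone_axioms T.Y.abstract_cone_axioms, rotated])
  interpret Q: quasi_normed_cone ?Q ?p
    by (rule XN.quasi_normed_cone_quotient) fact
  have lin: "cone_linear ?Q Y ?T"
    using ind assms(3) by (rule N.cone_linear_quotient)
  interpret QT: quasi_normed_cone_linear ?Q ?p Y q ?T
    by unfold_locales fact

  have T_class: "T a = T x" if "x \<in> carrier X" "a \<in> cone_class X ?N x" for x a
    using that ind[of x] ind[of a] N.class_closed N.class_eq_iff by metis
  \<comment> \<open>The constant \<open>M\<close> is left general because the bound descends twice:
    with \<open>\<bar>K\<bar>\<close> for continuity and with the norm of \<open>T\<close> for the
    equality of norms. The proof divides by \<open>M\<close>, hence the sign condition and the
    separate case \<open>M = 0\<close>.\<close>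
  have descend: "q (?T A) \<le> M * ?p A"
    if M: "\<And>x. x \<in> carrier X \<Longrightarrow> q (T x) \<le> M * p x" "M \<ge> 0" and A: "A \<in> carrier ?Q" for M A
  proof -
    obtain x where x: "x \<in> carrier X" "A = cone_class X ?N x"
      using A by (rule N.quotient_carrierE)
    show ?thesis
    proof (cases "M = 0")
      case True
      then show ?thesis using M(1)[OF x(1)] x ind by simp
    next
      case False
      have "q (T x) / M \<le> ?p (cone_class X ?N x)"
      proof (rule XN.quotient_norm_greatest[OF x(1)])
        fix a assume a: "a \<in> cone_class X ?N x"
        then show "q (T x) / M \<le> p a"
          using M(1)[of a] M(2) False N.class_closed[OF x(1) a] T_class[OF x(1) a]
          by (simp add: field_simps)
      qed
      then show ?thesis using False M(2) x ind by (simp add: field_simps)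
    qed
  qed
  obtain K where K: "\<And>x. x \<in> carrier X \<Longrightarrow> q (T x) \<le> K * p x"
    using T.bounded_if_continuous assms(5) by blast
  have K': "q (T x) \<le> \<bar>K\<bar> * p x" if "x \<in> carrier X" for x
    using K[OF that] mult_right_mono[OF _ T.X.qnorm_nonneg[OF that], of K "\<bar>K\<bar>"] by linarith
  have cont: "continuous_map (qtopology ?Q ?p) (qtopology Y q) ?T"
    using descend[OF K'] by (intro QT.continuous_if_bounded[of "\<bar>K\<bar>"]) auto

  have norm: "map_norm ?Q ?p q ?T = map_norm X p q T"
  proof (rule antisym)
    \<comment> \<open>This bound excludes \<infinity> and nonnegativity excludes -\<infinity>, so
      the norm is a real \<open>M\<close>, which is itself an admissible constant for
      \<open>descend\<close>.\<close>
    have "map_norm X p q T \<le> ereal \<bar>K\<bar>" by (rule T.map_norm_leI[OF K']) auto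
    then obtain M where M: "map_norm X p q T = ereal M" "M \<ge> 0"
      using T.map_norm_nonneg by (cases "map_norm X p q T") auto
    have "q (T x) \<le> M * p x" if "x \<in> carrier X" for x
      using T.le_map_norm_mult[OF K _ that] M by simp
    then show "map_norm ?Q ?p q ?T \<le> map_norm X p q T"
      unfolding M(1) using M(2) descend by (intro QT.map_norm_leI) auto
    show "map_norm X p q T \<le> map_norm ?Q ?p q ?T"
      unfolding map_norm_def
    proof (rule Sup_mono, clarify)
      fix x assume x: "x \<in> carrier X" "p x \<le> 1"
      \<comment> \<open>Passing to the class does not increase the quasi-norm, so the unit ball of
        \<open>X\<close> maps into that of the quotient, and the values under \<open>T\<close> and
        the induced map agree.\<close>
      then have "?p (cone_class X ?N x) \<le> 1"
        using XN.quotient_norm_le[OF x(1) N.class_self] by simp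
      then show "\<exists>b\<in>{ereal (q (?T A)) |A. A \<in> carrier ?Q \<and> ?p A \<le> 1}. ereal (q (T x)) \<le> b"
        using x by (intro bexI[of _ "ereal (q (T x))"])
          (auto simp: ind N.class_in_quotient intro!: exI[of _ "cone_class X ?N x"])
    qed
  qed

  have iso: "cone_isomorphism ?Q ?p Y q ?T"
    if opn: "open_map (qtopology X p) (qtopology Y q) T" and Ginj: "G_injective X Y T"
  proof -
    have inj: "inj_on ?T (carrier ?Q)"
    proof (rule inj_onI)
      fix A B assume "A \<in> carrier ?Q" "B \<in> carrier ?Q" and eq: "?T A = ?T B"
      then obtain x y where *: "x \<in> carrier X" "A = cone_class X ?N x"
        "y \<in> carrier X" "B = cone_class X ?N y"
        by (metis N.quotient_carrierE)
      then have "T y = T x" using eq ind by simp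
      \<comment> \<open>\<open>G_injective\<close> is exactly the injectivity of the induced map,
        expressed on representatives.\<close>
      then have "x \<in> cone_class X ?N y" using * Ginj unfolding G_injective_def by blast
      then show "A = B" using * N.class_eq_iff by simp
    qed
    have "?T ` carrier ?Q = carrier Y"
    proof -
      have "carrier ?Q = cone_class X ?N ` carrier X" by (auto simp: quotient_cone_def)
      then show ?thesis using ind assms(4) by (simp add: image_image)
    qed
    with inj have bij: "bij_betw ?T (carrier ?Q) (carrier Y)" by (simp add: bij_betw_def)
    let ?S = "inv_into (carrier ?Q) ?T"
    \<comment> \<open>The inverse is again linear, so its continuity need only be checked at
      zero.\<close>
    interpret S: quasi_normed_cone_linear Y q ?Q ?p ?S
      by unfold_locales (rule cone_linear_inv_into[OF Q.abstract_cone_axioms lin bij])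
    have "continuous_map (qtopology Y q) (qtopology ?Q ?p) ?S"
    proof (rule S.continuous_if_at_zero)
      fix e :: real assume e: "e > 0"
      have "openin (qtopology Y q) (T ` qball X p \<zero>\<^bsub>X\<^esub> e)"
        using opn e T.X.openin_qball by (simp add: open_map_def)
      moreover have "\<zero>\<^bsub>Y\<^esub> \<in> T ` qball X p \<zero>\<^bsub>X\<^esub> e"
        using e T.map_zero T.X.qnorm_zero by (force simp: T.X.mem_qball_zero_iff)
      \<comment> \<open>The image of the \<open>e\<close>-ball at zero is an open set containing
        zero, so every \<open>y\<close> with \<open>q y < d\<close> has a preimage \<open>x\<close>
        with \<open>p x < e\<close>. The inverse sends \<open>y\<close> to the class of
        \<open>x\<close>, whose quasi-norm is at most \<open>p x\<close>.\<close>
      ultimately obtain d where d: "d > 0" "qball Y q \<zero>\<^bsub>Y\<^esub> d \<subseteq> T ` qball X p \<zero>\<^bsub>X\<^esub> e"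
        unfolding T.Y.openin_qtopology by blast
      have "?p (?S y) < e" if y: "y \<in> carrier Y" "q y < d" for y
      proof -
        have "y \<in> T ` qball X p \<zero>\<^bsub>X\<^esub> e"
          using y d(2) T.Y.mem_qball_zero_iff by blast
        then obtain x where x: "x \<in> carrier X" "p x < e" "y = T x"
          by (auto simp: T.X.mem_qball_zero_iff)
        have "?S y = cone_class X ?N x"
          using x ind inj by (intro inv_into_f_eq) (auto simp: N.class_in_quotient)
        then show ?thesis
          using x XN.quotient_norm_le[OF x(1) N.class_self[OF x(1)]] by simp
      qed
      then show "\<exists>d>0. \<forall>y\<in>carrier Y. q y < d \<longrightarrow> ?p (?S y) < e" using d(1) by blast
    qed
    with cont lin bij show ?thesis by (simp add: cone_isomorphism_def)
  qed
  show ?thesis using cont norm iso by blast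
qed

end
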